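(* Let $m\ge2$ and let $A$ be an $m\times m$ real matrix with singular value decomposition $A=U\Sigma V^T$ such that $\sigma_1>\sigma_2>\sigma_3\ge0$. Let $\mathbb{X}_1=\mathrm{span}\{\mathbf{x}_1\}$ for some $\mathbf{x}_1=\sum_{i=1}^m w_i\mathbf{u}_i\in\mathbb{R}^m$ with $\|\mathbf{x}_1\|=1$. Then the subspace $\mathbb{X}_1$ is optimal for $\mathcal{A}$ if and only if $w_2=0$ and $$\sum_{i=3}^m\frac{w_i^2}{\sigma_2^2-\sigma_i^2}\le\frac{w_1^2}{\sigma_1^2-\sigma_2^2}.$$
   Context: $\|\cdot\|$ is the Euclidean norm. $A=U\Sigma V^T$ is any singular value decomposition: $U,V$ are orthogonal with $j$-th columns $\mathbf{u}_j,\mathbf{v}_j$, and $\Sigma$ is diagonal with diagonal entries $\sigma_1\ge\cdots\ge\sigma_m\ge0$; by convention $\sigma_{m+1}:=0$. Set $\mathcal{A}:=\{A\mathbf{x}:\mathbf{x}\in\mathbb{R}^m,\ \|\mathbf{x}\|\le1\}$. For a subspace $\mathbb{X}$ of $\mathbb{R}^m$, $E(\mathcal{A},\mathbb{X}):=\max_{\mathbf{a}\in\mathcal{A}}\min_{\mathbf{x}\in\mathbb{X}}\|\mathbf{a}-\mathbf{x}\|$, and $d_1(\mathcal{A}):=\min E(\mathcal{A},\mathbb{X})$ over all one-dimensional subspaces $\mathbb{X}$ of $\mathbb{R}^m$. A one-dimensional subspace $\mathbb{X}_1$ is optimal for $\mathcal{A}$ if $E(\mathcal{A},\mathbb{X}_1)=d_1(\mathcal{A})$.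 *)

theory Defs
  imports "HOL-Analysis.Analysis"
begin

(* The coordinates of real^'m carry no order, so e :: nat => 'm is an arbitrary numbering
   e 1, ..., e m of them, m = CARD('m). Outside 1, ..., m the value is 0, which gives the
   convention sigma_{m+1} = 0. *)
definition diag_entry :: "(nat \<Rightarrow> 'm) \<Rightarrow> real^'m^'m \<Rightarrow> nat \<Rightarrow> real" where
  "diag_entry e S k = (if k \<in> {1..CARD('m)} then S $ e k $ e k else 0)"

definition is_svd ::
  "(nat \<Rightarrow> 'm::finite) \<Rightarrow> real^'m^'m \<Rightarrow> real^'m^'m \<Rightarrow> real^'m^'m \<Rightarrow> real^'m^'m \<Rightarrow> bool" where
  "is_svd e A U S V \<longleftrightarrow>
     orthogonal_matrix U \<and> orthogonal_matrix V \<and>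
     (\<forall>i j. i \<noteq> j \<longrightarrow> S $ i $ j = 0) \<and>
     (\<forall>k\<in>{1..CARD('m)}. 0 \<le> diag_entry e S k) \<and>
     (\<forall>k\<in>{1..CARD('m)}. \<forall>l\<in>{1..CARD('m)}. k \<le> l \<longrightarrow> diag_entry e S l \<le> diag_entry e S k) \<and>
     A = U ** S ** transpose V"

definition unit_ball_image :: "real^'m^'m \<Rightarrow> (real^'m) set" where
  "unit_ball_image A = {A *v x | x. norm x \<le> 1}"

(* For compact nonempty S the suprema and infima in the next two definitions are attained;
   see the lemmas below. *)
definition deviation :: "'a::euclidean_space set \<Rightarrow> 'a set \<Rightarrow> real" where
  "deviation S X = (SUP a\<in>S. INF x\<in>X. norm (a - x))"

definition width1 :: "'a::euclidean_space set \<Rightarrow> real" where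
  "width1 S = (INF X\<in>{X. subspace X \<and> dim X = 1}. deviation S X)"

definition optimal1 :: "'a::euclidean_space set \<Rightarrow> 'a set \<Rightarrow> bool" where
  "optimal1 S X \<longleftrightarrow> subspace X \<and> dim X = 1 \<and> deviation S X = width1 S"

lemma unit_ball_image_compact: "compact (unit_ball_image A)" "unit_ball_image A \<noteq> {}"
proof -
  have eq: "unit_ball_image A = (*v) A ` cball 0 1"
    by (auto simp: unit_ball_image_def)
  show "compact (unit_ball_image A)" unfolding eq
    by (intro compact_continuous_image linear_continuous_on) (simp_all add: matrix_vector_mul_bounded_linear)
  show "unit_ball_image A \<noteq> {}" unfolding eq by simp
qed

lemma INF_norm_eq_infdist:
  assumes "X \<noteq> {}"
  shows "(INF x\<in>X. norm (a - x)) = infdist a X"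
  using assms by (simp add: infdist_def dist_norm)

lemma INF_norm_attained:
  fixes X :: "'a::euclidean_space set"
  assumes "subspace X"
  shows "\<exists>x\<in>X. (INF y\<in>X. norm (a - y)) = norm (a - x) \<and> (\<forall>y\<in>X. norm (a - x) \<le> norm (a - y))"
proof -
  have ne: "X \<noteq> {}" using assms subspace_0 by blast
  obtain x where x: "x \<in> X" "infdist a X = dist a x"
    using infdist_attains_inf[OF closed_subspace[OF assms] ne, of a] by auto
  then have "norm (a - x) \<le> norm (a - y)" if "y \<in> X" for y
    using infdist_le[OF that, of a] by (simp add: dist_norm)
  then show ?thesis using x INF_norm_eq_infdist[OF ne] by (auto simp: dist_norm)
qed

lemma deviation_attained:
  fixes S X :: "'a::euclidean_space set"
  assumes "compact S" "S \<noteq> {}" "subspace X"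
  shows "\<exists>a\<in>S. deviation S X = (INF x\<in>X. norm (a - x)) \<and>
           (\<forall>b\<in>S. (INF x\<in>X. norm (b - x)) \<le> (INF x\<in>X. norm (a - x)))"
proof -
  have ne: "X \<noteq> {}" using assms subspace_0 by blast
  have "continuous_on S (\<lambda>a. infdist a X)" by (intro continuous_intros)
  then obtain a where a: "a \<in> S" "\<forall>b\<in>S. infdist b X \<le> infdist a X"
    using continuous_attains_sup[OF assms(1,2)] by blast
  then have "deviation S X = infdist a X"
    unfolding deviation_def INF_norm_eq_infdist[OF ne] by (intro cSup_eq_maximum) auto
  then show ?thesis using a by (auto simp: INF_norm_eq_infdist[OF ne])
qed

lemma deviation_span_le:
  fixes S :: "'a::euclidean_space set"
  assumes S: "compact S" "S \<noteq> {}" and B: "\<And>a. a \<in> S \<Longrightarrow> norm a \<le> B"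
    and "norm x = 1"
  shows "deviation S (span {y}) \<le> deviation S (span {x}) + B * norm (x - y)"
proof -
  obtain a where a: "a \<in> S" "deviation S (span {y}) = (INF z\<in>span {y}. norm (a - z))"
    using deviation_attained[OF S subspace_span[of "{y}"]] by metis
  obtain b where b: "deviation S (span {x}) = (INF z\<in>span {x}. norm (b - z))"
    "\<forall>c\<in>S. (INF z\<in>span {x}. norm (c - z)) \<le> (INF z\<in>span {x}. norm (b - z))"
    using deviation_attained[OF S subspace_span[of "{x}"]] by metis
  have ne: "span {v} \<noteq> {}" for v :: 'a using span_zero by blast
  obtain z where z: "z \<in> span {x}" "infdist a (span {x}) = norm (a - z)"
    using INF_norm_attained[OF subspace_span[of "{x}"], of a] INF_norm_eq_infdist[OF ne] by metis
  then obtain t where t: "z = t *\<^sub>R x" by (auto simp: span_singleton)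
  let ?s = "a \<bullet> x"
  have xx: "x \<bullet> x = 1" using assms(4) by (simp add: dot_square_norm)
  have "(norm (a - t *\<^sub>R x))\<^sup>2 - (norm (a - ?s *\<^sub>R x))\<^sup>2 = (t - ?s)\<^sup>2"
    unfolding power2_norm_eq_inner
    by (simp add: inner_diff_left inner_diff_right xx inner_commute[of x a]
        power2_eq_square algebra_simps)
  then have le: "norm (a - ?s *\<^sub>R x) \<le> norm (a - t *\<^sub>R x)"
    by (metis diff_ge_0_iff_ge norm_ge_zero power2_le_imp_le zero_le_power2)
  have s: "\<bar>?s\<bar> \<le> B"
    using Cauchy_Schwarz_ineq2[of a x] B[OF a(1)] assms(4) by simp
  have "?s *\<^sub>R y \<in> span {y}" by (simp add: span_base span_scale)
  then have "deviation S (span {y}) \<le> norm (a - ?s *\<^sub>R y)"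
    using a INF_norm_eq_infdist[OF ne] infdist_le[of _ "span {y}" a] by (simp add: dist_norm)
  also have "\<dots> \<le> norm (a - ?s *\<^sub>R x) + norm (?s *\<^sub>R (x - y))"
    using norm_triangle_ineq[of "a - ?s *\<^sub>R x" "?s *\<^sub>R (x - y)"] by (simp add: algebra_simps)
  also have "\<dots> \<le> deviation S (span {x}) + B * norm (x - y)"
  proof (rule add_mono)
    show "norm (a - ?s *\<^sub>R x) \<le> deviation S (span {x})"
      using le z t b a(1) INF_norm_eq_infdist[OF ne] by (metis order_trans)
    show "norm (?s *\<^sub>R (x - y)) \<le> B * norm (x - y)"
      using s by (simp add: mult_right_mono)
  qed
  finally show ?thesis .
qed

lemma width1_attained:
  fixes S :: "'a::euclidean_space set"
  assumes S: "compact S" "S \<noteq> {}"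
  shows "\<exists>X. optimal1 S X \<and> (\<forall>Y. subspace Y \<and> dim Y = 1 \<longrightarrow> deviation S X \<le> deviation S Y)"
proof -
  obtain B where B: "B > 0" "\<And>a. a \<in> S \<Longrightarrow> norm a \<le> B"
    using compact_imp_bounded[OF S(1)] bounded_pos by metis
  let ?f = "\<lambda>x. deviation S (span {x})"
  have "B-lipschitz_on (sphere 0 1) ?f"
  proof (rule lipschitz_onI)
    fix x y :: 'a assume "x \<in> sphere 0 1" "y \<in> sphere 0 1"
    then show "dist (?f x) (?f y) \<le> B * dist x y"
      using deviation_span_le[OF S B(2), of x y] deviation_span_le[OF S B(2), of y x]
      by (simp add: dist_norm norm_minus_commute abs_le_iff)
  qed (use B in simp)
  then have "continuous_on (sphere 0 1) ?f" by (rule lipschitz_on_continuous_on)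
  moreover have "sphere (0::'a) 1 \<noteq> {}" by simp
  ultimately obtain x where x: "norm x = 1" "\<forall>y. norm y = 1 \<longrightarrow> ?f x \<le> ?f y"
    using continuous_attains_inf[OF compact_sphere, of 0 1 ?f] by auto
  have le: "?f x \<le> deviation S Y" if Y: "subspace Y" "dim Y = 1" for Y
  proof -
    obtain D where D: "D \<subseteq> Y" "independent D" "Y \<subseteq> span D" "card D = 1"
      using basis_exists[of Y] unfolding Y(2) by metis
    then obtain d where d: "D = {d}" by (auto simp: card_1_singleton_iff)
    have "d \<noteq> 0" using D(2) d dependent_zero by blast
    have "Y = span {d}" using D d Y(1) span_minimal by blast
    also have "\<dots> = span {d /\<^sub>R norm d}"
    proof (intro subset_antisym span_minimal subspace_span)
      have "d = norm d *\<^sub>R (d /\<^sub>R norm d)" using \<open>d \<noteq> 0\<close> by simp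
      then show "{d} \<subseteq> span {d /\<^sub>R norm d}" by (metis empty_subsetI insert_subset
          singletonI span_base span_scale)
      show "{d /\<^sub>R norm d} \<subseteq> span {d}" by (simp add: span_base span_scale)
    qed
    finally show ?thesis using x \<open>d \<noteq> 0\<close> by simp
  qed
  have "x \<noteq> 0" using x by auto
  then have X: "subspace (span {x})" "dim (span {x}) = 1"
    by (simp_all add: dim_span)
  have "width1 S = ?f x" unfolding width1_def
    by (rule cInf_eq_minimum) (use X le in auto)
  then have "optimal1 S (span {x})" unfolding optimal1_def using X by metis
  then show ?thesis using le by blast
qed

end

(* In the coordinates of the columns of U, the set is the image of the unit ball under
   y |-> (sigma_i y_i), and the squared distance of a to span {x} is |a|^2 - (a . x)^2 for a unit
   vector x.  Every line has deviation at least sigma_2, because some nonzero y supported on the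
   first two coordinates maps to a vector orthogonal to x; the first column of U attains sigma_2.
   Hence span {x} is optimal iff
     sum_i (sigma_i^2 - sigma_2^2) y_i^2 <= (sum_i sigma_i w_i y_i)^2   for all y.
   A test vector on the first two coordinates forces w_2 = 0.  What remains is equivalent, by the
   Cauchy-Schwarz inequality and its equality case, to
     (sigma_1^2 - sigma_2^2) (1 + Q) <= sigma_1^2 w_1^2
   with Q = sum_{i>=3} sigma_i^2 w_i^2 / (sigma_2^2 - sigma_i^2), and sum_i w_i^2 = 1 turns
   this into the stated inequality. *)

theory Submission
  imports Defs
begin

subsection \<open>Deviation from a line\<close>

text \<open>Completing the square in \<open>t\<close> shows that the squared distance from
  \<open>a\<close> to \<open>t *\<^sub>R x\<close> exceeds the claimed value by exactly the square
  of \<open>t - a \<bullet> x\<close>. The minimum is therefore at the orthogonal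
  projection.\<close>

lemma infdist_span_singleton_power2:
  fixes a x :: "'a::euclidean_space"
  assumes "norm x = 1"
  shows "(infdist a (span {x}))\<^sup>2 = a \<bullet> a - (a \<bullet> x)\<^sup>2"
proof -
  have ne: "span {x} \<noteq> {}" using span_zero by blast
  have xx: "x \<bullet> x = 1" using assms by (simp add: dot_square_norm)
  have eq: "(dist a (t *\<^sub>R x))\<^sup>2 = a \<bullet> a - (a \<bullet> x)\<^sup>2 + (t - a \<bullet> x)\<^sup>2" for t
    unfolding dist_norm power2_norm_eq_inner
    by (simp add: inner_diff_left inner_diff_right xx inner_commute[of x a]
        power2_eq_square algebra_simps)
  have "infdist a (span {x}) \<le> dist a ((a \<bullet> x) *\<^sub>R x)"
    by (intro infdist_le) (simp add: span_base span_scale)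
  then have "(infdist a (span {x}))\<^sup>2 \<le> (dist a ((a \<bullet> x) *\<^sub>R x))\<^sup>2"
    by (simp add: infdist_nonneg power_mono)
  moreover obtain z where z: "z \<in> span {x}" "infdist a (span {x}) = dist a z"
    using infdist_attains_inf[OF closed_subspace[OF subspace_span] ne] by metis
  then obtain t where "z = t *\<^sub>R x" by (auto simp: span_singleton)
  ultimately show ?thesis using z eq[of t] eq[of "a \<bullet> x"] by simp
qed

text \<open>The maximum over \<open>T\<close> is attained, so bounding it means bounding every
  point. Both sides of each bound are nonnegative, so they may be squared.\<close>

lemma deviation_span_le_iff:
  fixes T :: "'a::euclidean_space set"
  assumes T: "compact T" "T \<noteq> {}" and x: "norm x = 1" and r: "0 \<le> r"
  shows "deviation T (span {x}) \<le> r \<longleftrightarrow> (\<forall>a\<in>T. a \<bullet> a - (a \<bullet> x)\<^sup>2 \<le> r\<^sup>2)"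
proof -
  have ne: "span {x} \<noteq> {}" using span_zero by blast
  have "deviation T (span {x}) \<le> r \<longleftrightarrow> (\<forall>a\<in>T. infdist a (span {x}) \<le> r)"
    using deviation_attained[OF T subspace_span[of "{x}"]]
    unfolding INF_norm_eq_infdist[OF ne] by force
  also have "\<dots> \<longleftrightarrow> (\<forall>a\<in>T. (infdist a (span {x}))\<^sup>2 \<le> r\<^sup>2)"
    using r infdist_nonneg by (metis abs_le_square_iff abs_of_nonneg)
  finally show ?thesis by (simp add: infdist_span_singleton_power2[OF x])
qed

lemma deviation_nonneg:
  fixes T :: "'a::euclidean_space set"
  assumes "compact T" "T \<noteq> {}" "subspace X"
  shows "0 \<le> deviation T X"
proof -
  have "X \<noteq> {}" using assms(3) subspace_0 by blast
  then show ?thesis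
    using deviation_attained[OF assms] by (auto simp: INF_norm_eq_infdist infdist_nonneg)
qed

lemma one_dim_subspace_span_unit:
  fixes Y :: "'a::euclidean_space set"
  assumes "subspace Y" "dim Y = 1"
  obtains x where "norm x = 1" "Y = span {x}"
proof -
  obtain B where B: "\<And>x. x \<in> B \<Longrightarrow> norm x = 1" "card B = 1" "span B = Y"
    using orthonormal_basis_subspace[OF assms(1)] assms(2) by metis
  then obtain x where "B = {x}" by (auto simp: card_1_singleton_iff)
  then show ?thesis using that B by blast
qed

subsection \<open>The quadratic inequality\<close>

lemma sum_split_first_two:
  fixes f :: "nat \<Rightarrow> real"
  assumes "n \<ge> 2"
  shows "(\<Sum>i=1..n. f i) = f 1 + f 2 + (\<Sum>i=3..n. f i)"
proof -
  have "{1..n} = insert 1 (insert 2 {3..n})" using assms by auto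
  then show ?thesis by simp
qed

text \<open>On the left the coefficient is positive at i = 1, zero at i = 2 and negative from i = 3
  on. Moving the negative terms across leaves one square to be bounded by a squared linear form plus
  a positive definite form, whose minimum for fixed \<open>y 1\<close> is explicit.\<close>

lemma quadratic_inequality_iff:
  fixes \<sigma> w :: "nat \<Rightarrow> real"
  assumes n: "n \<ge> 2" and s12: "\<sigma> 1 > \<sigma> 2" and s2: "\<sigma> 2 > 0"
    and s: "\<And>i. i \<in> {3..n} \<Longrightarrow> 0 \<le> \<sigma> i \<and> \<sigma> i < \<sigma> 2"
    and w: "(\<Sum>i=1..n. (w i)\<^sup>2) = 1"
  shows "(\<forall>y. (\<Sum>i=1..n. ((\<sigma> i)\<^sup>2 - (\<sigma> 2)\<^sup>2) * (y i)\<^sup>2) \<le> (\<Sum>i=1..n. \<sigma> i * w i * y i)\<^sup>2)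
    \<longleftrightarrow> w 2 = 0 \<and>
      (\<Sum>i=3..n. (w i)\<^sup>2 / ((\<sigma> 2)\<^sup>2 - (\<sigma> i)\<^sup>2)) \<le> (w 1)\<^sup>2 / ((\<sigma> 1)\<^sup>2 - (\<sigma> 2)\<^sup>2)"
    (is "(\<forall>y. ?ineq y) \<longleftrightarrow> _ \<and> ?P \<le> _")
proof -
  define c where "c = (\<sigma> 1)\<^sup>2 - (\<sigma> 2)\<^sup>2"
  define d where "d i = (\<sigma> 2)\<^sup>2 - (\<sigma> i)\<^sup>2" for i
  \<comment> \<open>\<open>Q\<close> is the squared dual norm of the linear form with coefficients
    sigma_i w_i, i \<ge> 3, when the norm is weighted by \<open>d\<close>.\<close>
  define Q where "Q = (\<Sum>i=3..n. (\<sigma> i * w i)\<^sup>2 / d i)"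
  have c: "c > 0" unfolding c_def using s12 s2 by (simp add: power_strict_mono)
  have d: "d i > 0" if "i \<in> {3..n}" for i
    unfolding d_def using s[OF that] by (simp add: power_strict_mono)
  have Q: "Q \<ge> 0" unfolding Q_def using d by (intro sum_nonneg) (auto simp: less_imp_le)
  have ineq: "?ineq y \<longleftrightarrow> c * (y 1)\<^sup>2 \<le>
      (\<sigma> 1 * w 1 * y 1 + \<sigma> 2 * w 2 * y 2 + (\<Sum>i=3..n. \<sigma> i * w i * y i))\<^sup>2
      + (\<Sum>i=3..n. d i * (y i)\<^sup>2)" for y
  proof -
    have "(\<Sum>i=3..n. ((\<sigma> i)\<^sup>2 - (\<sigma> 2)\<^sup>2) * (y i)\<^sup>2) = - (\<Sum>i=3..n. d i * (y i)\<^sup>2)"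
      unfolding d_def by (simp add: sum_negf[symmetric] algebra_simps)
    then show ?thesis unfolding sum_split_first_two[OF n] c_def by (intro iffI) simp_all
  qed
  have w2: "w 2 = 0" if "\<forall>y. ?ineq y"
  proof -
    \<comment> \<open>This test vector annihilates the linear form and has no entries from 3 on, so
      the right side is 0.\<close>
    have "c * (\<sigma> 2 * w 2)\<^sup>2 \<le> 0"
      using that[unfolded ineq, rule_format,
          of "\<lambda>i. if i = 1 then \<sigma> 2 * w 2 else if i = 2 then - \<sigma> 1 * w 1 else 0"]
      by (simp add: algebra_simps)
    then show ?thesis using c s2 by (simp add: mult_le_0_iff)
  qed
  have main: "(\<forall>y. ?ineq y) \<longleftrightarrow> c * (1 + Q) \<le> (\<sigma> 1 * w 1)\<^sup>2" if w2: "w 2 = 0"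
  proof
    assume "\<forall>y. ?ineq y"
    \<comment> \<open>The equality case of Cauchy-Schwarz: for \<open>y 1\<close> = 1 the minimiser
      of the right side has entries proportional to sigma_i w_i / d_i, and scaling by 1 +
      \<open>Q\<close> clears its denominator. The formula divides by \<open>d 2\<close> = 0 at i =
      2, but \<open>y 2\<close> only meets the factor \<open>w 2\<close> = 0.\<close>
    define y where "y i = (if i = 1 then 1 + Q else - \<sigma> 1 * w 1 * (\<sigma> i * w i / d i))" for i :: nat
    have "(\<Sum>i=3..n. \<sigma> i * w i * y i) = - \<sigma> 1 * w 1 * Q"
      unfolding Q_def sum_distrib_left
      by (intro sum.cong) (auto simp: y_def power2_eq_square)
    moreover have "(\<Sum>i=3..n. d i * (y i)\<^sup>2) = (\<sigma> 1 * w 1)\<^sup>2 * Q"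
      unfolding Q_def sum_distrib_left
    proof (intro sum.cong refl)
      fix i assume "i \<in> {3..n}"
      then show "d i * (y i)\<^sup>2 = (\<sigma> 1 * w 1)\<^sup>2 * ((\<sigma> i * w i)\<^sup>2 / d i)"
        using d[of i] by (simp add: y_def power2_eq_square field_simps)
    qed
    moreover have "y 1 = 1 + Q" by (simp add: y_def)
    ultimately have "c * (1 + Q)\<^sup>2 \<le>
        (\<sigma> 1 * w 1 * (1 + Q) + - \<sigma> 1 * w 1 * Q)\<^sup>2 + (\<sigma> 1 * w 1)\<^sup>2 * Q"
      using \<open>\<forall>y. ?ineq y\<close>[unfolded ineq, rule_format, of y] w2 by simp
    also have "\<dots> = (\<sigma> 1 * w 1)\<^sup>2 * (1 + Q)" by (simp add: algebra_simps power2_eq_square)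
    finally have "(c * (1 + Q)) * (1 + Q) \<le> (\<sigma> 1 * w 1)\<^sup>2 * (1 + Q)"
      by (simp add: power2_eq_square mult.assoc)
    then show "c * (1 + Q) \<le> (\<sigma> 1 * w 1)\<^sup>2" using Q by simp
  next
    assume le: "c * (1 + Q) \<le> (\<sigma> 1 * w 1)\<^sup>2"
    show "\<forall>y. ?ineq y" unfolding ineq
    proof
      fix y :: "nat \<Rightarrow> real"
      define t where "t = (\<Sum>i=3..n. \<sigma> i * w i * y i)"
      \<comment> \<open>Since \<open>w 2\<close> = 0, \<open>g\<close> is the whole linear form, and
        g - t recovers its first term.\<close>
      define g where "g = \<sigma> 1 * w 1 * y 1 + t"
      define D where "D = (\<Sum>i=3..n. d i * (y i)\<^sup>2)"
      \<comment> \<open>Distributing \<open>sqrt (d i)\<close> over the two factors makes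
        Cauchy-Schwarz produce exactly \<open>Q\<close> and \<open>D\<close>.\<close>
      have "t = (\<Sum>i=3..n. (\<sigma> i * w i / sqrt (d i)) * (sqrt (d i) * y i))"
        unfolding t_def
      proof (intro sum.cong refl)
        fix i assume "i \<in> {3..n}"
        then show "\<sigma> i * w i * y i = (\<sigma> i * w i / sqrt (d i)) * (sqrt (d i) * y i)"
          using d[of i] by simp
      qed
      then have "t\<^sup>2 \<le> (\<Sum>i=3..n. (\<sigma> i * w i / sqrt (d i))\<^sup>2) * (\<Sum>i=3..n. (sqrt (d i) * y i)\<^sup>2)"
        using Cauchy_Schwarz_ineq_sum by metis
      also have "\<dots> = Q * D" unfolding Q_def D_def
        using d by (intro arg_cong2[of _ _ _ _ times] sum.cong)
          (auto simp: power_divide power_mult_distrib less_imp_le)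
      finally have t: "t\<^sup>2 \<le> Q * D" .
      have D: "0 \<le> D" unfolding D_def using d by (intro sum_nonneg) (auto simp: less_imp_le)
      \<comment> \<open>Cauchy-Schwarz for the vectors (1, sqrt Q) and (g, sqrt D)\<close>
      have "(g - t)\<^sup>2 \<le> (1 + Q) * (g\<^sup>2 + D)"
      proof -
        have "\<bar>t\<bar> \<le> sqrt Q * sqrt D"
          using t by (metis real_sqrt_abs real_sqrt_le_mono real_sqrt_mult)
        then have "\<bar>g\<bar> * \<bar>t\<bar> \<le> \<bar>g\<bar> * (sqrt Q * sqrt D)" by (intro mult_left_mono) auto
        moreover have "- (g * t) \<le> \<bar>g\<bar> * \<bar>t\<bar>"
          using abs_ge_minus_self[of "g * t"] by (simp only: abs_mult)
        ultimately have "- (2 * g * t) \<le> 2 * (\<bar>g\<bar> * sqrt Q) * sqrt D" by (simp add: mult_ac)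
        also have "\<dots> \<le> (\<bar>g\<bar> * sqrt Q)\<^sup>2 + (sqrt D)\<^sup>2" by (rule sum_squares_bound)
        also have "\<dots> = g\<^sup>2 * Q + D" using Q D by (simp add: power_mult_distrib)
        finally show ?thesis using t by (simp add: power2_eq_square algebra_simps)
      qed
      moreover have "c * (1 + Q) * (y 1)\<^sup>2 \<le> (\<sigma> 1 * w 1)\<^sup>2 * (y 1)\<^sup>2"
        using le by (intro mult_right_mono) auto
      moreover have "(\<sigma> 1 * w 1)\<^sup>2 * (y 1)\<^sup>2 = (g - t)\<^sup>2"
        by (simp add: g_def power_mult_distrib)
      ultimately have "(1 + Q) * (c * (y 1)\<^sup>2) \<le> (1 + Q) * (g\<^sup>2 + D)"
        by (simp add: mult_ac)
      then have "c * (y 1)\<^sup>2 \<le> g\<^sup>2 + D" using Q by simp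
      then show "c * (y 1)\<^sup>2 \<le>
          (\<sigma> 1 * w 1 * y 1 + \<sigma> 2 * w 2 * y 2 + (\<Sum>i=3..n. \<sigma> i * w i * y i))\<^sup>2
          + (\<Sum>i=3..n. d i * (y i)\<^sup>2)"
        using w2 by (simp add: g_def t_def D_def)
    qed
  qed
  have "c * (1 + Q) \<le> (\<sigma> 1 * w 1)\<^sup>2 \<longleftrightarrow> ?P \<le> (w 1)\<^sup>2 / c" if w2: "w 2 = 0"
  proof -
    \<comment> \<open>Writing sigma_i^2 as sigma_2^2 - d_i splits each term; the subtracted squares
      are then summed by the normalisation of \<open>w\<close>.\<close>
    have "Q = (\<Sum>i=3..n. (\<sigma> 2)\<^sup>2 * ((w i)\<^sup>2 / d i) - (w i)\<^sup>2)"
      unfolding Q_def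
    proof (intro sum.cong refl)
      fix i assume "i \<in> {3..n}"
      then show "(\<sigma> i * w i)\<^sup>2 / d i = (\<sigma> 2)\<^sup>2 * ((w i)\<^sup>2 / d i) - (w i)\<^sup>2"
        using d[of i] by (simp add: field_simps power_mult_distrib) (simp add: d_def algebra_simps)
    qed
    also have "\<dots> = (\<sigma> 2)\<^sup>2 * ?P - (\<Sum>i=3..n. (w i)\<^sup>2)"
      by (simp add: d_def sum_subtractf sum_distrib_left)
    also have "(\<Sum>i=3..n. (w i)\<^sup>2) = 1 - (w 1)\<^sup>2"
      using w w2 unfolding sum_split_first_two[OF n] by simp
    finally have "1 + Q = (\<sigma> 2)\<^sup>2 * ?P + (w 1)\<^sup>2" by simp
    \<comment> \<open>The term c w_1^2 is taken off both sides; sigma_1^2 - c = sigma_2^2 leaves a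
      common factor sigma_2^2.\<close>
    then have "c * (1 + Q) \<le> (\<sigma> 1 * w 1)\<^sup>2 \<longleftrightarrow> (\<sigma> 2)\<^sup>2 * (c * ?P) \<le> (\<sigma> 2)\<^sup>2 * (w 1)\<^sup>2"
      by (simp add: c_def algebra_simps power_mult_distrib)
    also have "\<dots> \<longleftrightarrow> c * ?P \<le> (w 1)\<^sup>2" using s2 by simp
    finally show ?thesis using c by (simp add: field_simps)
  qed
  then show ?thesis using w2 main c_def by blast
qed

subsection \<open>Coordinates of a singular value decomposition\<close>

lemma sum_bij_betw_UNIV:
  fixes e :: "nat \<Rightarrow> 'm::finite" and f :: "'m \<Rightarrow> real"
  assumes "bij_betw e I UNIV"
  shows "sum f UNIV = (\<Sum>i\<in>I. f (e i))"
  using sum.reindex_bij_betw[OF assms, of f] by simp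

lemma inner_vec_bij_betw:
  fixes u v :: "real^'m" and e :: "nat \<Rightarrow> 'm"
  assumes "bij_betw e I UNIV"
  shows "u \<bullet> v = (\<Sum>i\<in>I. u $ e i * v $ e i)"
  unfolding inner_vec_def using sum_bij_betw_UNIV[OF assms] by simp

lemma orthogonal_matrix_inner:
  fixes U :: "real^'n^'n"
  assumes "orthogonal_matrix U"
  shows "(U *v a) \<bullet> (U *v b) = a \<bullet> b"
  using assms orthogonal_transformation_matrix[of "(*v) U"]
  by (simp add: orthogonal_transformation_def)

lemma orthogonal_matrix_norm:
  fixes U :: "real^'n^'n"
  assumes "orthogonal_matrix U"
  shows "norm (U *v a) = norm a"
  by (simp add: norm_eq_sqrt_inner orthogonal_matrix_inner[OF assms])

lemma orthogonal_matrix_transpose_cancel: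
  fixes U :: "real^'n^'n"
  assumes "orthogonal_matrix U"
  shows "U *v (transpose U *v x) = x" "transpose U *v (U *v x) = x"
  using assms by (simp_all add: orthogonal_matrix_def matrix_vector_mul_assoc del: transpose_matrix_vector)

text \<open>\<open>V\<close> drops out because an orthogonal matrix maps the unit ball onto
  itself.\<close>

lemma unit_ball_image_svd:
  assumes "is_svd e A U S V"
  shows "unit_ball_image A = {U *v (S *v y) | y. norm y \<le> 1}"
proof -
  have V: "orthogonal_matrix V" and A: "A = U ** S ** transpose V"
    using assms by (auto simp: is_svd_def)
  have A': "A *v x = U *v (S *v (transpose V *v x))" for x
    unfolding A by (simp add: matrix_vector_mul_assoc matrix_mul_assoc del: transpose_matrix_vector)
  have "orthogonal_matrix (transpose V)" using V by (simp add: orthogonal_matrix_transpose)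
  note nV = orthogonal_matrix_norm[OF this]
  show ?thesis
  proof (intro subset_antisym subsetI)
    fix a assume "a \<in> unit_ball_image A"
    then show "a \<in> {U *v (S *v y) | y. norm y \<le> 1}"
      using nV by (auto simp: unit_ball_image_def A' simp del: transpose_matrix_vector)
  next
    fix a assume "a \<in> {U *v (S *v y) | y. norm y \<le> 1}"
    then obtain y where y: "a = U *v (S *v y)" "norm y \<le> 1" by auto
    then have "a = A *v (V *v y)" "norm (V *v y) \<le> 1"
      using V by (simp_all add: A' orthogonal_matrix_transpose_cancel orthogonal_matrix_norm
          del: transpose_matrix_vector)
    then show "a \<in> unit_ball_image A" by (auto simp: unit_ball_image_def)
  qed
qed

lemma svd_diag_nth:
  fixes e :: "nat \<Rightarrow> 'm::finite" and y :: "real^'m"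
  assumes "is_svd e A U S V" "i \<in> {1..CARD('m)}"
  shows "(S *v y) $ e i = diag_entry e S i * y $ e i"
proof -
  have "S $ e i $ j = 0" if "j \<noteq> e i" for j
    using assms(1) that unfolding is_svd_def by metis
  then have "(\<Sum>j\<in>UNIV. S $ e i $ j * y $ j)
      = (\<Sum>j\<in>UNIV. if j = e i then S $ e i $ e i * y $ e i else 0)"
    by (intro sum.cong) auto
  then have "(S *v y) $ e i = S $ e i $ e i * y $ e i" by (simp add: matrix_vector_mult_def)
  then show ?thesis using assms(2) by (simp add: diag_entry_def)
qed

text \<open>As \<open>U\<close> preserves inner products, everything can be computed with the
  coordinates \<open>b\<close> of the line. At r = sigma_2 the right side has the form treated by
  \<open>quadratic_inequality_iff\<close>.\<close>

lemma deviation_svd_le_iff: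
  fixes e :: "nat \<Rightarrow> 'm::finite" and b :: "real^'m"
  assumes svd: "is_svd e A U S V" and e: "bij_betw e {1..CARD('m)} UNIV"
    and b: "norm b = 1" and r: "0 \<le> r"
  defines "\<sigma> \<equiv> diag_entry e S"
  shows "deviation (unit_ball_image A) (span {U *v b}) \<le> r \<longleftrightarrow>
    (\<forall>y. (\<Sum>i=1..CARD('m). ((\<sigma> i)\<^sup>2 - r\<^sup>2) * (y i)\<^sup>2)
          \<le> (\<Sum>i=1..CARD('m). \<sigma> i * b $ e i * y i)\<^sup>2)"
proof -
  let ?I = "{1..CARD('m)}"
  have U: "orthogonal_matrix U" using svd by (simp add: is_svd_def)
  define F where "F y = (S *v y) \<bullet> (S *v y) - ((S *v y) \<bullet> b)\<^sup>2" for y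
  have "deviation (unit_ball_image A) (span {U *v b}) \<le> r \<longleftrightarrow> (\<forall>y. norm y \<le> 1 \<longrightarrow> F y \<le> r\<^sup>2)"
    unfolding deviation_span_le_iff[OF unit_ball_image_compact
        orthogonal_matrix_norm[OF U, of b, unfolded b] r]
    unfolding unit_ball_image_svd[OF svd] F_def
    by (auto simp: orthogonal_matrix_inner[OF U])
  \<comment> \<open>\<open>F\<close> is homogeneous of degree 2, so normalising \<open>y\<close>
    removes the restriction to the unit ball.\<close>
  also have "\<dots> \<longleftrightarrow> (\<forall>y. F y \<le> r\<^sup>2 * (y \<bullet> y))"
  proof safe
    fix y assume *: "\<forall>y. norm y \<le> 1 \<longrightarrow> F y \<le> r\<^sup>2"
    show "F y \<le> r\<^sup>2 * (y \<bullet> y)"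
    proof (cases "y = 0")
      case False
      define z where "z = y /\<^sub>R norm y"
      have "F z \<le> r\<^sup>2" using * False by (simp add: z_def)
      moreover have "F y = (norm y)\<^sup>2 * F z"
      proof -
        have "y = norm y *\<^sub>R z" using False by (simp add: z_def)
        then have "S *v y = norm y *\<^sub>R (S *v z)" by (metis matrix_vector_mult_scaleR)
        then show ?thesis unfolding F_def by (simp add: power2_eq_square algebra_simps)
      qed
      ultimately show ?thesis
        using mult_left_mono[of "F z" "r\<^sup>2" "(norm y)\<^sup>2"]
        by (simp add: dot_square_norm mult.commute)
    qed (simp add: F_def)
  next
    fix y :: "real^'m" assume *: "\<forall>y. F y \<le> r\<^sup>2 * (y \<bullet> y)" "norm y \<le> 1"
    then have "y \<bullet> y \<le> 1" by (simp add: dot_square_norm power_le_one)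
    then show "F y \<le> r\<^sup>2"
      using *(1)[rule_format, of y] mult_left_mono[of "y \<bullet> y" 1 "r\<^sup>2"] by simp
  qed
  also have "\<dots> \<longleftrightarrow> (\<forall>y::real^'m. (\<Sum>i\<in>?I. ((\<sigma> i)\<^sup>2 - r\<^sup>2) * (y $ e i)\<^sup>2)
          \<le> (\<Sum>i\<in>?I. \<sigma> i * b $ e i * y $ e i)\<^sup>2)"
  proof -
    have Sb: "(S *v y) \<bullet> b = (\<Sum>i\<in>?I. \<sigma> i * b $ e i * y $ e i)" for y
      unfolding inner_vec_bij_betw[OF e] \<sigma>_def
      by (intro sum.cong) (auto simp: svd_diag_nth[OF svd])
    have SS: "(S *v y) \<bullet> (S *v y) = (\<Sum>i\<in>?I. (\<sigma> i)\<^sup>2 * (y $ e i)\<^sup>2)" for y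
      unfolding inner_vec_bij_betw[OF e] \<sigma>_def
      by (intro sum.cong) (auto simp: svd_diag_nth[OF svd] power2_eq_square)
    have yy: "r\<^sup>2 * (y \<bullet> y) = (\<Sum>i\<in>?I. r\<^sup>2 * (y $ e i)\<^sup>2)" for y
      unfolding inner_vec_bij_betw[OF e] by (simp add: power2_eq_square sum_distrib_left)
    show ?thesis unfolding F_def Sb SS yy
      by (simp add: left_diff_distrib sum_subtractf algebra_simps)
  qed
  also have "\<dots> \<longleftrightarrow> (\<forall>y. (\<Sum>i\<in>?I. ((\<sigma> i)\<^sup>2 - r\<^sup>2) * (y i)\<^sup>2)
          \<le> (\<Sum>i\<in>?I. \<sigma> i * b $ e i * y i)\<^sup>2)" (is "?L \<longleftrightarrow> ?R")
  proof
    assume L: ?L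
    show ?R
    proof
      fix y :: "nat \<Rightarrow> real"
      \<comment> \<open>Only the values of \<open>y\<close> on \<open>?I\<close> enter the sums, so
        \<open>y\<close> can be turned into a vector by inverting the numbering
        \<open>e\<close>.\<close>
      define z :: "real^'m" where "z = (\<chi> j. y (the_inv_into ?I e j))"
      have "z $ e i = y i" if "i \<in> ?I" for i
        using e that by (simp add: z_def bij_betw_def the_inv_into_f_f)
      then show "(\<Sum>i\<in>?I. ((\<sigma> i)\<^sup>2 - r\<^sup>2) * (y i)\<^sup>2) \<le> (\<Sum>i\<in>?I. \<sigma> i * b $ e i * y i)\<^sup>2"
        using L[rule_format, of z] by simp
    qed
  next
    assume R: ?R
    show ?L
    proof
      fix y :: "real^'m"
      show "(\<Sum>i\<in>?I. ((\<sigma> i)\<^sup>2 - r\<^sup>2) * (y $ e i)\<^sup>2) \<le> (\<Sum>i\<in>?I. \<sigma> i * b $ e i * y $ e i)\<^sup>2"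
        using R[rule_format, of "\<lambda>i. y $ e i"] by simp
    qed
  qed
  finally show ?thesis .
qed

section \<open>The width as the second singular value\<close>

lemma width1_svd:
  fixes A :: "real^'m^'m"
  assumes n: "CARD('m) \<ge> 2" and e: "bij_betw e {1..CARD('m)} UNIV" and svd: "is_svd e A U S V"
  shows "width1 (unit_ball_image A) = diag_entry e S 2"
proof -
  define \<sigma> where "\<sigma> = diag_entry e S"
  let ?I = "{1..CARD('m)}" and ?T = "unit_ball_image A"
  have U: "orthogonal_matrix U" using svd by (simp add: is_svd_def)
  have s: "0 \<le> \<sigma> i" if "i \<in> ?I" for i
    using svd that unfolding is_svd_def \<sigma>_def by blast
  have mono: "\<sigma> j \<le> \<sigma> i" if "i \<in> ?I" "j \<in> ?I" "i \<le> j" for i j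
    using svd that unfolding is_svd_def \<sigma>_def by blast
  have s2: "0 \<le> \<sigma> 2" using s[of 2] n by simp
  have s12: "(\<sigma> 2)\<^sup>2 \<le> (\<sigma> 1)\<^sup>2" using mono[of 1 2] n s2 by (simp add: power_mono)
  \<comment> \<open>A minimising line exists, so both bounds can be proved for its
    deviation.\<close>
  obtain X where X: "optimal1 ?T X"
    "\<And>Y. subspace Y \<Longrightarrow> dim Y = 1 \<Longrightarrow> deviation ?T X \<le> deviation ?T Y"
    using width1_attained[OF unit_ball_image_compact] by metis
  have sub: "subspace X" "dim X = 1" and W: "width1 ?T = deviation ?T X"
    using X(1) by (auto simp: optimal1_def)
  let ?r = "deviation ?T X"
  have r: "0 \<le> ?r" using deviation_nonneg[OF unit_ball_image_compact sub(1)] .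
  obtain x where x: "norm x = 1" "X = span {x}"
    using one_dim_subspace_span_unit[OF sub] .
  define b where "b = transpose U *v x"
  have xb: "x = U *v b" using U by (simp add: b_def orthogonal_matrix_transpose_cancel del: transpose_matrix_vector)
  have nb: "norm b = 1" using x orthogonal_matrix_norm[OF U, of b] xb by simp
  have lower: "\<sigma> 2 \<le> ?r"
  proof -
    \<comment> \<open>One linear equation in two unknowns has a nonzero solution; it gives a vector
      whose image under \<open>S\<close> is orthogonal to \<open>b\<close>.\<close>
    have "\<exists>p q :: real. (p \<noteq> 0 \<or> q \<noteq> 0) \<and> \<sigma> 1 * b $ e 1 * p + \<sigma> 2 * b $ e 2 * q = 0"
    proof (cases "\<sigma> 1 * b $ e 1 = 0")
      case True
      then show ?thesis by (intro exI[of _ 1] exI[of _ 0]) simp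
    next
      case False
      then show ?thesis
        by (intro exI[of _ "- (\<sigma> 2 * b $ e 2)"] exI[of _ "\<sigma> 1 * b $ e 1"]) simp
    qed
    then obtain p q :: real where pq: "p \<noteq> 0 \<or> q \<noteq> 0"
      "\<sigma> 1 * b $ e 1 * p + \<sigma> 2 * b $ e 2 * q = 0" by blast
    define y where "y i = (if i = 1 then p else if i = 2 then q else 0)" for i :: nat
    have y3: "(\<Sum>i=3..CARD('m). f i * (y i)\<^sup>2) = 0" "(\<Sum>i=3..CARD('m). f i * y i) = 0" for f
      by (auto simp: y_def intro!: sum.neutral)
    have y12: "y 1 = p" "y 2 = q" by (simp_all add: y_def)
    have "(\<Sum>i\<in>?I. ((\<sigma> i)\<^sup>2 - ?r\<^sup>2) * (y i)\<^sup>2) \<le> (\<Sum>i\<in>?I. \<sigma> i * b $ e i * y i)\<^sup>2"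
      using deviation_svd_le_iff[OF svd e nb r] unfolding xb[symmetric] x(2)[symmetric] \<sigma>_def
      by blast
    then have "((\<sigma> 1)\<^sup>2 - ?r\<^sup>2) * p\<^sup>2 + ((\<sigma> 2)\<^sup>2 - ?r\<^sup>2) * q\<^sup>2 \<le> 0"
      unfolding sum_split_first_two[OF n] y3 y12 pq(2) by simp
    \<comment> \<open>Lowering sigma_1 to sigma_2 makes the two coefficients equal, so the positive
      factor p^2 + q^2 can be cancelled.\<close>
    moreover have "((\<sigma> 2)\<^sup>2 - ?r\<^sup>2) * p\<^sup>2 \<le> ((\<sigma> 1)\<^sup>2 - ?r\<^sup>2) * p\<^sup>2"
      using s12 by (intro mult_right_mono) auto
    ultimately have "((\<sigma> 2)\<^sup>2 - ?r\<^sup>2) * (p\<^sup>2 + q\<^sup>2) \<le> 0" by (simp add: distrib_left)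
    moreover have "p\<^sup>2 + q\<^sup>2 > 0" using pq(1) by (simp add: sum_power2_gt_zero_iff)
    ultimately have "(\<sigma> 2)\<^sup>2 \<le> ?r\<^sup>2" by (simp add: mult_le_0_iff)
    then show ?thesis using r by (rule power2_le_imp_le)
  qed
  have upper: "?r \<le> \<sigma> 2"
  proof -
    \<comment> \<open>The first column of \<open>U\<close>, the direction of the longest semi-axis,
      serves as competitor.\<close>
    define u :: "real^'m" where "u = U *v axis (e 1) 1"
    have n1: "norm (axis (e 1) 1 :: real^'m) = 1" by simp
    then have nu: "norm u = 1" unfolding u_def by (simp only: orthogonal_matrix_norm[OF U])
    have ax: "(axis (e 1) 1 :: real^'m) $ e i = (if i = 1 then 1 else 0)" if "i \<in> ?I" for i
    proof -
      have "e i = e 1 \<longleftrightarrow> i = 1"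
        using inj_on_eq_iff[OF bij_betw_imp_inj_on[OF e] that, of 1] n by simp
      then show ?thesis by (simp add: axis_def)
    qed
    have "deviation ?T (span {u}) \<le> \<sigma> 2"
      unfolding u_def deviation_svd_le_iff[OF svd e n1 s2] \<sigma>_def[symmetric]
    proof
      fix y :: "nat \<Rightarrow> real"
      have "(\<Sum>i\<in>?I. \<sigma> i * (axis (e 1) 1 :: real^'m) $ e i * y i)
          = (\<Sum>i\<in>?I. if i = 1 then \<sigma> 1 * y 1 else 0)"
        by (intro sum.cong refl) (simp add: ax del: One_nat_def)
      then have "(\<Sum>i\<in>?I. \<sigma> i * (axis (e 1) 1 :: real^'m) $ e i * y i) = \<sigma> 1 * y 1"
        using n by simp
      \<comment> \<open>The right side is now sigma_1^2 y_1^2, which dominates the term i = 1 on the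
        left; the term i = 2 is zero, and the ordering of the singular values makes the rest
        nonpositive.\<close>
      moreover have "(\<Sum>i=3..CARD('m). ((\<sigma> i)\<^sup>2 - (\<sigma> 2)\<^sup>2) * (y i)\<^sup>2) \<le> 0"
        using s mono n by (intro sum_nonpos mult_nonpos_nonneg) (auto simp: power_mono)
      ultimately show "(\<Sum>i\<in>?I. ((\<sigma> i)\<^sup>2 - (\<sigma> 2)\<^sup>2) * (y i)\<^sup>2)
          \<le> (\<Sum>i\<in>?I. \<sigma> i * (axis (e 1) 1 :: real^'m) $ e i * y i)\<^sup>2"
        unfolding sum_split_first_two[OF n, of "\<lambda>i. ((\<sigma> i)\<^sup>2 - (\<sigma> 2)\<^sup>2) * (y i)\<^sup>2"]
        by (simp add: left_diff_distrib power_mult_distrib) (rule order_trans[of _ 0]; simp)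
    qed
    moreover have "u \<noteq> 0" using nu by auto
    ultimately show ?thesis using X(2)[of "span {u}"] by (simp add: dim_span)
  qed
  show ?thesis using lower upper W by (simp add: \<sigma>_def)
qed

section \<open>The optimality criterion, from the width and the quadratic inequality\<close>

theorem theorem6:
  fixes A U S V :: "real^'m^'m" and e :: "nat \<Rightarrow> 'm" and \<sigma> w :: "nat \<Rightarrow> real"
    and x\<^sub>1 :: "real^'m"
  assumes "CARD('m) \<ge> 2"
    and "bij_betw e {1..CARD('m)} UNIV"
    and "is_svd e A U S V"
    and "\<sigma> = diag_entry e S"
    and "\<sigma> 1 > \<sigma> 2" and "\<sigma> 2 > \<sigma> 3" and "\<sigma> 3 \<ge> 0"
    and "x\<^sub>1 = (\<Sum>i=1..CARD('m). w i *\<^sub>R column (e i) U)"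
    and "norm x\<^sub>1 = 1"
  shows "optimal1 (unit_ball_image A) (span {x\<^sub>1}) \<longleftrightarrow>
    w 2 = 0 \<and>
    (\<Sum>i=3..CARD('m). (w i)\<^sup>2 / ((\<sigma> 2)\<^sup>2 - (\<sigma> i)\<^sup>2)) \<le> (w 1)\<^sup>2 / ((\<sigma> 1)\<^sup>2 - (\<sigma> 2)\<^sup>2)"
proof -
  note n = assms(1) and e = assms(2) and svd = assms(3)
  let ?I = "{1..CARD('m)}" and ?T = "unit_ball_image A"
  have U: "orthogonal_matrix U" using svd by (simp add: is_svd_def)
  \<comment> \<open>The coefficients \<open>w\<close> are carried over to a vector indexed by
    \<open>'m\<close>, so that \<open>U *v b\<close> is the given combination of columns.\<close>
  define b :: "real^'m" where "b = (\<chi> j. w (the_inv_into ?I e j))"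
  have b: "b $ e i = w i" if "i \<in> ?I" for i
    using e that by (simp add: b_def bij_betw_def the_inv_into_f_f)
  have xb: "x\<^sub>1 = U *v b"
  proof -
    have "U *v b = (\<Sum>j\<in>UNIV. b $ j *\<^sub>R column j U)"
      by (simp add: matrix_mult_sum scalar_mult_eq_scaleR)
    also have "\<dots> = (\<Sum>i\<in>?I. b $ e i *\<^sub>R column (e i) U)"
      by (rule sum.reindex_bij_betw[OF e, symmetric])
    finally show ?thesis using assms(8) b by simp
  qed
  have nb: "norm b = 1" using assms(9) orthogonal_matrix_norm[OF U, of b] xb by simp
  have "b \<bullet> b = 1" using nb by (simp add: dot_square_norm)
  then have w: "(\<Sum>i\<in>?I. (w i)\<^sup>2) = 1"
    unfolding inner_vec_bij_betw[OF e] using b by (simp add: power2_eq_square)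
  have s: "0 \<le> \<sigma> i \<and> \<sigma> i < \<sigma> 2" if i: "i \<in> {3..CARD('m)}" for i
  proof -
    have "0 \<le> \<sigma> i" using svd i unfolding is_svd_def assms(4) by auto
    moreover have "\<sigma> i \<le> \<sigma> 3" using svd i unfolding is_svd_def assms(4) by auto
    ultimately show ?thesis using assms(6) by simp
  qed
  \<comment> \<open>If \<open>CARD('m)\<close> = 2, then \<open>\<sigma> 3\<close> is the default
    value 0 of \<open>diag_entry\<close>, and the chain of inequalities still gives
    positivity.\<close>
  have s2: "0 < \<sigma> 2" using assms by simp
  have "x\<^sub>1 \<noteq> 0" using assms(9) by auto
  then have "optimal1 ?T (span {x\<^sub>1}) \<longleftrightarrow> deviation ?T (span {x\<^sub>1}) = \<sigma> 2"
    using width1_svd[OF n e svd] by (simp add: optimal1_def dim_span assms(4))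
  \<comment> \<open>Since sigma_2 is the minimum over all lines, the reverse inequality always
    holds.\<close>
  also have "\<dots> \<longleftrightarrow> deviation ?T (span {x\<^sub>1}) \<le> \<sigma> 2"
  proof -
    obtain X where "optimal1 ?T X"
      "\<And>Y. subspace Y \<Longrightarrow> dim Y = 1 \<Longrightarrow> deviation ?T X \<le> deviation ?T Y"
      using width1_attained[OF unit_ball_image_compact] by metis
    then have "\<sigma> 2 \<le> deviation ?T (span {x\<^sub>1})"
      using width1_svd[OF n e svd] \<open>x\<^sub>1 \<noteq> 0\<close> by (simp add: optimal1_def dim_span assms(4))
    then show ?thesis by auto
  qed
  also have "\<dots> \<longleftrightarrow> (\<forall>y. (\<Sum>i\<in>?I. ((\<sigma> i)\<^sup>2 - (\<sigma> 2)\<^sup>2) * (y i)\<^sup>2)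
      \<le> (\<Sum>i\<in>?I. \<sigma> i * w i * y i)\<^sup>2)"
  proof -
    have "(\<Sum>i\<in>?I. \<sigma> i * b $ e i * y i) = (\<Sum>i\<in>?I. \<sigma> i * w i * y i)" for y
      using b by (intro sum.cong refl) simp
    then show ?thesis
      using deviation_svd_le_iff[OF svd e nb less_imp_le[OF s2], folded xb assms(4)] by simp
  qed
  also have "\<dots> \<longleftrightarrow> w 2 = 0 \<and>
    (\<Sum>i=3..CARD('m). (w i)\<^sup>2 / ((\<sigma> 2)\<^sup>2 - (\<sigma> i)\<^sup>2)) \<le> (w 1)\<^sup>2 / ((\<sigma> 1)\<^sup>2 - (\<sigma> 2)\<^sup>2)"
    by (rule quadratic_inequality_iff[OF n assms(5) s2 s w])
  finally show ?thesis .
qed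

end
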